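(* Let $K\subset\mathbb{R}^n$ be a closed set whose complement $K^c$ is a bounded open set, let $\alpha\ge0$, $\lambda>0$, $\mu\in(0,1]$ and $\alpha'$ with $0<\alpha'\le\alpha$ such that $r_\mu^{\alpha'}(K)>\alpha+\lambda$. Then $\mathrm{ax}_\lambda^\alpha(K)$ has the same homotopy type as $(K^{\oplus\alpha'})^c$.
   Context: For a closed set $K\subset\mathbb{R}^n$ with bounded open complement: $R_K(x)=d(x,K)$; $\Theta_K(x)=\{y\in K:\|x-y\|=R_K(x)\}$; for bounded $S$, $\mathrm{center}(S)$ and $\mathrm{radius}(S)$ are the center and radius of the smallest ball enclosing $S$; $\mathcal F_K(x)=\mathrm{radius}(\Theta_K(x))$; for $x\notin K$, $\nabla_K(x)=(x-\mathrm{center}(\Theta_K(x)))/R_K(x)$. $R_{\max}(K)=\max_{x\in K^c}R_K(x)$. Critical function: $\chi_K(t)=\inf\{\|\nabla_K(x)\|:R_K(x)=t\}$ for $t\in(0,R_{\max}(K)]$ (infimum of empty set $=1$). $K^{\oplus\alpha}=\{x:d(x,K)\le\alpha\}$. For $\mu\in(0,1]$, $\alpha\ge0$: $r_\mu^\alpha(K)=\inf\{t>\alpha:\chi_K(t)<\mu\}$. $\mathrm{ax}_\lambda^\alpha(K)=\{x:\mathcal F_{K^{\oplus\alpha}}(x)\ge\lambda\}$. *)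

theory Defs
  imports "HOL-Analysis.Analysis"
begin

definition distK :: "'a::euclidean_space set \<Rightarrow> 'a \<Rightarrow> real" where
  "distK K x = infdist x K"

definition Theta :: "'a::euclidean_space set \<Rightarrow> 'a \<Rightarrow> 'a set" where
  "Theta K x = {y \<in> K. dist x y = distK K x}"

definition mradius :: "'a::euclidean_space set \<Rightarrow> real" where
  "mradius S = Inf {r. r \<ge> 0 \<and> (\<exists>c. S \<subseteq> cball c r)}"

definition mcenter :: "'a::euclidean_space set \<Rightarrow> 'a" where
  "mcenter S = (SOME c. S \<subseteq> cball c (mradius S))"

definition FK :: "'a::euclidean_space set \<Rightarrow> 'a \<Rightarrow> real" where
  "FK K x = mradius (Theta K x)"

text \<open>Generalised gradient, for x not in K.\<close>
definition gradK :: "'a::euclidean_space set \<Rightarrow> 'a \<Rightarrow> 'a" where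
  "gradK K x = (x - mcenter (Theta K x)) /\<^sub>R distK K x"

definition chiK :: "'a::euclidean_space set \<Rightarrow> real \<Rightarrow> real" where
  "chiK K t = (if {x. distK K x = t} = {} then 1
               else Inf ((\<lambda>x. norm (gradK K x)) ` {x. distK K x = t}))"

definition Rmax :: "'a::euclidean_space set \<Rightarrow> real" where
  "Rmax K = (SUP x\<in>- K. distK K x)"

definition offset :: "'a::euclidean_space set \<Rightarrow> real \<Rightarrow> 'a set" where
  "offset K \<alpha> = {x. infdist x K \<le> \<alpha>}"

text \<open>mu-reach r_mu^alpha(K) (extended real, inf of empty set = +infinity);
  t ranges over (alpha, Rmax K] where chi is defined.\<close>
definition rmu :: "real \<Rightarrow> real \<Rightarrow> 'a::euclidean_space set \<Rightarrow> ereal" where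
  "rmu \<mu> \<alpha> K = Inf {ereal t | t. \<alpha> < t \<and> 0 < t \<and> t \<le> Rmax K \<and> chiK K t < \<mu>}"

definition ax :: "real \<Rightarrow> real \<Rightarrow> 'a::euclidean_space set \<Rightarrow> 'a set" where
  "ax l \<alpha> K = {x. FK (offset K \<alpha>) x \<ge> l}"

end

theory Submission
  imports Defs
begin

text \<open>
  The function \<open>R\<^sup>2 - |x|\<^sup>2\<close>, with \<open>R\<close> the distance to \<open>K\<close>, is concave, and \<open>R \<nabla>\<close> is the
  supergradient of least norm of \<open>R\<^sup>2 / 2\<close>; thus \<open>F\<^sup>2 = R\<^sup>2 - |R \<nabla>|\<^sup>2\<close>. Instead of the gradient
  flow we use a single implicit Euler step for it: \<open>J\<^sub>s x\<close> is the minimiser of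
  \<open>|z - x|\<^sup>2 - s R(z)\<^sup>2\<close>. Semiconcavity makes \<open>J\<^sub>s x\<close> Lipschitz in \<open>(s, x)\<close> for \<open>s \<le> 1/2\<close>, and both \<open>R\<close>
  and \<open>F\<close> are nondecreasing under \<open>J\<^sub>s\<close>. Points at distance \<open>r > \<alpha>\<close> from \<open>K\<close> have
  \<open>F\<close> for the \<open>\<alpha>\<close>-offset equal to \<open>(r - \<alpha>) F / r\<close>, so \<open>J\<^sub>s\<close> preserves both spaces. Outside the
  \<open>\<lambda>\<close>-medial axis the assumption on the \<open>\<mu>\<close>-reach bounds \<open>|R \<nabla>|\<close> away from \<open>0\<close>, so there each step
  increases \<open>R\<^sup>2\<close> by a fixed amount. Since \<open>R\<close> is bounded, an iterate of \<open>J\<^sub>s\<close> with \<open>s = 1/2\<close> maps the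
  complement of the \<open>\<alpha>'\<close>-offset into the medial axis and is a homotopy inverse of the inclusion.
\<close>

section \<open>Supergradients of the squared distance\<close>

text \<open>Equivalently, \<open>2 * (w - z)\<close> is a supergradient at \<open>z\<close> of the
  concave function \<open>R^2 - |x|^2\<close>.\<close>

definition supgrad :: "'a::euclidean_space set \<Rightarrow> 'a \<Rightarrow> 'a \<Rightarrow> bool" where
  "supgrad K z w \<longleftrightarrow>
     (\<forall>y. (distK K y)\<^sup>2 \<le> (distK K z)\<^sup>2 + (norm (y - z))\<^sup>2 + 2 * (w \<bullet> (y - z)))"

lemma supgradD:
  "supgrad K z w \<Longrightarrow> (distK K y)\<^sup>2 \<le> (distK K z)\<^sup>2 + (norm (y - z))\<^sup>2 + 2 * (w \<bullet> (y - z))"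
  by (simp add: supgrad_def)

lemma distK_nonneg [simp]: "0 \<le> distK K x"
  by (simp add: distK_def infdist_nonneg)

lemma continuous_on_distK [continuous_intros]: "continuous_on S (distK K)"
  unfolding distK_def by (intro continuous_intros)

lemma distK_sq_le: "k \<in> K \<Longrightarrow> (distK K x)\<^sup>2 \<le> (norm (x - k))\<^sup>2"
  by (metis distK_def distK_nonneg dist_norm infdist_le power_mono)

lemma Theta_nonempty:
  assumes "closed K" "K \<noteq> {}"
  obtains k where "k \<in> Theta K x"
  using infdist_attains_inf[OF assms, of x] by (metis (mono_tags, lifting) Theta_def distK_def mem_Collect_eq)

lemma compact_Theta:
  assumes "closed K"
  shows "compact (Theta K x)"
proof -
  have "Theta K x = K \<inter> sphere x (distK K x)"
    by (auto simp: Theta_def)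
  then show ?thesis
    using assms by (simp add: closed_Int_compact)
qed

text \<open>The squared distance to one fixed point satisfies this with equality. Take that point
  nearest to the intermediate point; at the two ends it only overestimates
  \<open>distK\<close>.\<close>

lemma distK_semiconcave:
  fixes K :: "'a::euclidean_space set"
  assumes "closed K" "K \<noteq> {}" "0 \<le> t" "t \<le> 1"
  shows "(1 - t) * (distK K z)\<^sup>2 + t * (distK K y)\<^sup>2 - t * (1 - t) * (norm (y - z))\<^sup>2
           \<le> (distK K (z + t *\<^sub>R (y - z)))\<^sup>2"
proof -
  let ?m = "z + t *\<^sub>R (y - z)"
  obtain k where k: "k \<in> Theta K ?m"
    using Theta_nonempty assms(1,2) by blast
  then have "k \<in> K" and m: "distK K ?m = norm (?m - k)"
    by (auto simp: Theta_def dist_norm)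
  have eq: "(norm (?m - k))\<^sup>2
      = (1 - t) * (norm (z - k))\<^sup>2 + t * (norm (y - k))\<^sup>2 - t * (1 - t) * (norm (y - z))\<^sup>2"
    unfolding power2_norm_eq_inner
    by (simp add: algebra_simps inner_commute)
  have "(1 - t) * (distK K z)\<^sup>2 \<le> (1 - t) * (norm (z - k))\<^sup>2" "t * (distK K y)\<^sup>2 \<le> t * (norm (y - k))\<^sup>2"
    using assms \<open>k \<in> K\<close> by (auto intro!: mult_left_mono distK_sq_le)
  then show ?thesis
    unfolding m eq by linarith
qed

text \<open>Test each supergradient inequality at the base point of the other and add.\<close>

lemma supgrad_mono:
  assumes "supgrad K z w" "supgrad K z' w'"
  shows "(w - w') \<bullet> (z - z') \<le> (norm (z - z'))\<^sup>2"
proof -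
  have "w \<bullet> (z' - z) = - (w \<bullet> (z - z'))"
    by (simp add: inner_diff_right)
  then show ?thesis
    using supgradD[OF assms(1), of z'] supgradD[OF assms(2), of z]
    by (simp add: norm_minus_commute inner_diff_left)
qed

text \<open>For a nearest point \<open>k\<close>, the squared distance to \<open>k\<close> is a
  quadratic majorant of \<open>R^2\<close> touching it at \<open>z\<close>. The condition is affine
  in \<open>c\<close>, so it passes to the convex hull.\<close>

lemma supgrad_convex_hull_Theta:
  assumes "c \<in> convex hull Theta K z"
  shows "supgrad K z (z - c)"
proof -
  have "convex {c. supgrad K z (z - c)}"
  proof (rule convexI, clarsimp simp: supgrad_def)
    fix a b y :: 'a and u v :: real
    assume a: "\<forall>y. (distK K y)\<^sup>2 \<le> (distK K z)\<^sup>2 + (norm (y - z))\<^sup>2 + 2 * ((z - a) \<bullet> (y - z))"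
      and b: "\<forall>y. (distK K y)\<^sup>2 \<le> (distK K z)\<^sup>2 + (norm (y - z))\<^sup>2 + 2 * ((z - b) \<bullet> (y - z))"
      and uv: "0 \<le> u" "0 \<le> v" "u + v = 1"
    let ?A = "(distK K y)\<^sup>2" and ?B = "(distK K z)\<^sup>2 + (norm (y - z))\<^sup>2"
    have v: "v = 1 - u" using uv by simp
    have "u * ?A + v * ?A \<le> u * (?B + 2 * ((z - a) \<bullet> (y - z))) + v * (?B + 2 * ((z - b) \<bullet> (y - z)))"
      using a b uv by (intro add_mono mult_left_mono) auto
    also have "\<dots> = ?B + 2 * ((z - (u *\<^sub>R a + v *\<^sub>R b)) \<bullet> (y - z))"
      unfolding v by (simp add: algebra_simps)
    finally show "?A \<le> ?B + 2 * ((z - (u *\<^sub>R a + v *\<^sub>R b)) \<bullet> (y - z))"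
      unfolding v by (simp add: algebra_simps)
  qed
  moreover have "supgrad K z (z - k)" if "k \<in> Theta K z" for k
    unfolding supgrad_def
  proof
    fix y
    have "k \<in> K" and k: "distK K z = norm (z - k)"
      using that by (auto simp: Theta_def dist_norm)
    have "(norm (y - k))\<^sup>2 = (norm (z - k))\<^sup>2 + (norm (y - z))\<^sup>2 + 2 * ((z - k) \<bullet> (y - z))"
      unfolding power2_norm_eq_inner
      by (simp add: algebra_simps inner_commute)
    then show "(distK K y)\<^sup>2 \<le> (distK K z)\<^sup>2 + (norm (y - z))\<^sup>2 + 2 * ((z - k) \<bullet> (y - z))"
      using distK_sq_le[OF \<open>k \<in> K\<close>, of y] k by simp
  qed
  ultimately have "convex hull Theta K z \<subseteq> {c. supgrad K z (z - c)}"
    by (intro hull_minimal) auto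
  then show ?thesis using assms by blast
qed

text \<open>Every supergradient is dominated, in each direction, by one of the form \<open>z - k\<close> with
  \<open>k\<close> a nearest point of \<open>z\<close>: take \<open>k\<close> as a limit of nearest points of \<open>z + d / n\<close>.\<close>

lemma supgrad_direction:
  assumes "closed K" "K \<noteq> {}" "supgrad K z w"
  obtains k where "k \<in> Theta K z" "d \<bullet> (z - k) \<le> w \<bullet> d"
proof -
  define y where "y n = z + (1 / real (Suc n)) *\<^sub>R d" for n
  have "\<forall>n. \<exists>k. k \<in> Theta K (y n)"
    using Theta_nonempty assms(1,2) by metis
  then obtain k where k: "\<And>n. k n \<in> Theta K (y n)"
    by metis
  have kK: "k n \<in> K" and ky: "distK K (y n) = norm (y n - k n)" for n
    using k[of n] by (auto simp: Theta_def dist_norm)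
  have le: "d \<bullet> (z - k n) \<le> w \<bullet> d" for n
  proof -
    define t where "t = 1 / real (Suc n)"
    have "t > 0" by (simp add: t_def)
    have yn: "y n = z + t *\<^sub>R d" by (simp add: y_def t_def)
    \<comment> \<open>Both expansions contain the same term \<open>|t d|^2\<close>. It cancels, so
      the first-order inequality holds for every \<open>n\<close> without an error term.\<close>
    have "(norm (y n - k n))\<^sup>2 = (norm (z - k n))\<^sup>2 + 2 * t * (d \<bullet> (z - k n)) + (norm (t *\<^sub>R d))\<^sup>2"
      unfolding power2_norm_eq_inner yn
      by (simp add: algebra_simps inner_commute)
    moreover have "(distK K (y n))\<^sup>2 \<le> (distK K z)\<^sup>2 + (norm (t *\<^sub>R d))\<^sup>2 + 2 * t * (w \<bullet> d)"
      using supgradD[OF assms(3), of "y n"] by (simp add: yn)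
    ultimately have "2 * t * (d \<bullet> (z - k n)) \<le> 2 * t * (w \<bullet> d)"
      using distK_sq_le[OF kK[of n], of z] unfolding ky by linarith
    then show ?thesis using \<open>t > 0\<close> by simp
  qed
  have "(\<lambda>n. 1 / real (Suc n)) \<longlonglongrightarrow> 0"
    by (rule LIMSEQ_Suc) (rule lim_1_over_n)
  then have "(\<lambda>n. z + (1 / real (Suc n)) *\<^sub>R d) \<longlonglongrightarrow> z + 0 *\<^sub>R d"
    by (intro tendsto_add tendsto_scaleR tendsto_const)
  then have ylim: "y \<longlonglongrightarrow> z"
    by (simp add: y_def[abs_def])
  have Rlim: "(\<lambda>n. distK K (y n)) \<longlonglongrightarrow> distK K z"
    unfolding distK_def using ylim by (rule tendsto_infdist)
  have "bounded (range k)"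
  proof -
    have "bounded (range y)" "bounded (range (\<lambda>n. distK K (y n)))"
      using ylim Rlim convergent_imp_bounded by blast+
    then obtain A B where A: "\<And>n. norm (y n) \<le> A" and B: "\<And>n. distK K (y n) \<le> B"
      unfolding bounded_iff by (metis abs_le_D1 rangeI real_norm_def)
    have "norm (k n) \<le> A + B" for n
      using norm_triangle_ineq4[of "y n" "y n - k n"] A[of n] B[of n] ky[of n] by simp
    then show ?thesis by (auto simp: bounded_iff)
  qed
  then obtain l r where l: "strict_mono r" "(k \<circ> r) \<longlonglongrightarrow> l"
    using bounded_imp_convergent_subsequence by blast
  have "l \<in> K"
    using closed_sequentially[OF assms(1), of "k \<circ> r" l] kK l by auto
  have "(\<lambda>n. distK K (y (r n))) \<longlonglongrightarrow> distK K z" "(\<lambda>n. y (r n)) \<longlonglongrightarrow> z"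
    using LIMSEQ_subseq_LIMSEQ[OF Rlim l(1)] LIMSEQ_subseq_LIMSEQ[OF ylim l(1)] by (auto simp: o_def)
  moreover have "(\<lambda>n. norm (y (r n) - k (r n))) \<longlonglongrightarrow> norm (z - l)"
    using calculation(2) l(2) unfolding o_def by (intro tendsto_intros)
  ultimately have "distK K z = norm (z - l)"
    unfolding ky by (metis LIMSEQ_unique)
  with \<open>l \<in> K\<close> have "l \<in> Theta K z"
    by (simp add: Theta_def dist_norm)
  moreover have "d \<bullet> (z - l) \<le> w \<bullet> d"
  proof (rule LIMSEQ_le_const2)
    show "(\<lambda>n. d \<bullet> (z - k (r n))) \<longlonglongrightarrow> d \<bullet> (z - l)"
      using l(2) unfolding o_def by (intro tendsto_intros)
  qed (use le in blast)
  ultimately show thesis using that by blast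
qed

section \<open>Smallest enclosing ball of the nearest points\<close>

text \<open>In the direction \<open>z - q\<close>, \<open>supgrad_direction\<close> supplies a
  nearest point far from \<open>q\<close>. The last square on the left will also give uniqueness of
  the optimal centre.\<close>

lemma enclosing_ball_lower_bound:
  assumes "closed K" "K \<noteq> {}" "supgrad K z w" "Theta K z \<subseteq> cball q r"
  shows "(distK K z)\<^sup>2 - (norm w)\<^sup>2 + (norm (z - w - q))\<^sup>2 \<le> r\<^sup>2"
proof -
  obtain k where k: "k \<in> Theta K z" "(z - q) \<bullet> (z - k) \<le> w \<bullet> (z - q)"
    using supgrad_direction[OF assms(1-3)] by metis
  have "norm (k - q) \<le> r"
    using k(1) assms(4) by (auto simp: dist_norm norm_minus_commute)
  then have "(norm (k - q))\<^sup>2 \<le> r\<^sup>2"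
    by (simp add: power_mono)
  moreover have "distK K z = norm (z - k)"
    using k(1) by (simp add: Theta_def dist_norm)
  moreover have "(norm (k - q))\<^sup>2 - (norm (z - k))\<^sup>2 + 2 * ((z - q) \<bullet> (z - k))
       = (norm (z - w - q))\<^sup>2 - (norm w)\<^sup>2 + 2 * (w \<bullet> (z - q))"
    unfolding power2_norm_eq_inner
    by (simp add: algebra_simps inner_commute)
  ultimately show ?thesis using k(2) by simp
qed

lemma mradius_eqI:
  assumes "0 \<le> r" "S \<subseteq> cball c r" "\<And>q \<rho>. 0 \<le> \<rho> \<Longrightarrow> S \<subseteq> cball q \<rho> \<Longrightarrow> r \<le> \<rho>"
  shows "mradius S = r"
  unfolding mradius_def using assms by (intro cInf_eq_minimum) auto

text \<open>The centre is the point \<open>e\<close> of the convex hull of \<open>Theta K z\<close>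
  closest to \<open>z\<close>. The obtuse angle at \<open>e\<close> puts all nearest points in the
  ball of squared radius \<open>R^2 - |z - e|^2\<close>, and the lower bound with
  \<open>w = z - e\<close> shows that no ball is smaller.\<close>

lemma mcenter_Theta:
  fixes K :: "'a::euclidean_space set" and z :: 'a
  assumes "closed K" "K \<noteq> {}"
  defines "c \<equiv> mcenter (Theta K z)"
  shows "supgrad K z (z - c)" "(FK K z)\<^sup>2 = (distK K z)\<^sup>2 - (norm (z - c))\<^sup>2"
    "0 \<le> FK K z" "Theta K z \<subseteq> cball c (FK K z)"
    "\<And>q \<rho>. 0 \<le> \<rho> \<Longrightarrow> Theta K z \<subseteq> cball q \<rho> \<Longrightarrow> FK K z \<le> \<rho>"
proof -
  let ?T = "Theta K z" and ?R = "distK K z"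
  have ne: "convex hull ?T \<noteq> {}"
    using Theta_nonempty[OF assms(1,2)] by (metis convex_hull_eq_empty empty_iff)
  have cl: "closed (convex hull ?T)"
    using compact_Theta[OF assms(1)] by (simp add: compact_convex_hull compact_imp_closed)
  define e where "e = closest_point (convex hull ?T) z"
  have eT: "e \<in> convex hull ?T"
    unfolding e_def using cl ne by (rule closest_point_in_set)
  have W: "supgrad K z (z - e)"
    using eT by (rule supgrad_convex_hull_Theta)
  define r where "r = sqrt (?R\<^sup>2 - (norm (z - e))\<^sup>2)"
  have sq: "(norm (y - e))\<^sup>2 \<le> ?R\<^sup>2 - (norm (z - e))\<^sup>2" if "y \<in> ?T" for y
  proof -
    have "(z - e) \<bullet> (y - e) \<le> 0"
      unfolding e_def using that cl
      by (intro closest_point_dot) (auto simp: hull_inc)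
    moreover have "?R = norm (z - y)"
      using that by (simp add: Theta_def dist_norm)
    moreover have "(norm (y - e))\<^sup>2 = (norm (z - y))\<^sup>2 - (norm (z - e))\<^sup>2 + 2 * ((z - e) \<bullet> (y - e))"
      unfolding power2_norm_eq_inner
      by (simp add: algebra_simps inner_commute)
    ultimately show ?thesis by simp
  qed
  obtain y0 where "y0 \<in> ?T"
    using Theta_nonempty[OF assms(1,2)] by blast
  then have nn: "0 \<le> ?R\<^sup>2 - (norm (z - e))\<^sup>2"
    using sq by (meson order_trans zero_le_power2)
  then have r2: "r\<^sup>2 = ?R\<^sup>2 - (norm (z - e))\<^sup>2" and r0: "0 \<le> r"
    by (simp_all add: r_def)
  have enc: "?T \<subseteq> cball e r"
  proof
    fix y assume "y \<in> ?T"
    then have "norm (y - e) \<le> r"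
      using r0 by (intro power2_le_imp_le[OF sq[folded r2]])
    then show "y \<in> cball e r"
      by (simp add: dist_norm norm_minus_commute)
  qed
  have low: "r\<^sup>2 + (norm (e - q))\<^sup>2 \<le> \<rho>\<^sup>2" if "?T \<subseteq> cball q \<rho>" for q \<rho>
    using enclosing_ball_lower_bound[OF assms(1,2) W that] by (simp add: r2)
  have least: "r \<le> \<rho>" if "0 \<le> \<rho>" "?T \<subseteq> cball q \<rho>" for q \<rho>
  proof (rule power2_le_imp_le)
    show "r\<^sup>2 \<le> \<rho>\<^sup>2"
      using low[OF that(2)] zero_le_power2[of "norm (e - q)"] by linarith
  qed (rule that(1))
  have mr: "mradius ?T = r"
    using r0 enc least by (rule mradius_eqI)
  \<comment> \<open>\<open>mcenter\<close> is an arbitrary choice among optimal centres;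
    \<open>low\<close> with \<rho> equal to \<open>r\<close> forces it to be
    \<open>e\<close>.\<close>
  have "?T \<subseteq> cball c r"
    unfolding c_def mcenter_def mr using enc by (rule someI)
  then have "(norm (e - c))\<^sup>2 \<le> 0"
    using low by fastforce
  then have "c = e" by simp
  then show "supgrad K z (z - c)" "(FK K z)\<^sup>2 = (distK K z)\<^sup>2 - (norm (z - c))\<^sup>2"
    "0 \<le> FK K z" "Theta K z \<subseteq> cball c (FK K z)"
    "\<And>q \<rho>. 0 \<le> \<rho> \<Longrightarrow> Theta K z \<subseteq> cball q \<rho> \<Longrightarrow> FK K z \<le> \<rho>"
    using W r2 r0 enc least by (auto simp: FK_def mr)
qed

text \<open>Apply the lower bound to the optimal ball itself and drop the square of the centre
  offset.\<close>

lemma mcenter_norm_le_supgrad: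
  assumes "closed K" "K \<noteq> {}" "supgrad K z w"
  shows "norm (z - mcenter (Theta K z)) \<le> norm w"
proof -
  have "(distK K z)\<^sup>2 - (norm w)\<^sup>2 \<le> (FK K z)\<^sup>2"
    using enclosing_ball_lower_bound[OF assms mcenter_Theta(4)[OF assms(1,2)]]
    by (smt (verit) zero_le_power2)
  then have "(norm (z - mcenter (Theta K z)))\<^sup>2 \<le> (norm w)\<^sup>2"
    unfolding mcenter_Theta(2)[OF assms(1,2)] by linarith
  then show ?thesis by (rule power2_le_imp_le) simp
qed

section \<open>Passing to offsets\<close>

text \<open>Nearest points of the offset are where the segments from \<open>x\<close> to its nearest
  points in \<open>K\<close> first meet the offset, so a homothety centred at \<open>x\<close>
  relates the two sets.\<close>

lemma Theta_offset:
  assumes "closed K" "K \<noteq> {}" "0 \<le> \<alpha>" "\<alpha> < distK K x"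
  defines "\<sigma> \<equiv> (distK K x - \<alpha>) / distK K x"
  shows "Theta (offset K \<alpha>) x = (\<lambda>y. x + \<sigma> *\<^sub>R (y - x)) ` Theta K x"
proof -
  let ?R = "distK K x" and ?O = "offset K \<alpha>"
  have R: "?R > 0" using assms by simp
  have \<sigma>: "\<sigma> * ?R = ?R - \<alpha>" "0 < \<sigma>" "\<sigma> \<le> 1"
    using assms R by (auto simp: \<sigma>_def)
  have low: "\<exists>k\<in>K. dist y k \<le> \<alpha>" if "y \<in> ?O" for y
    using that infdist_attains_inf[OF assms(1,2), of y] by (metis mem_Collect_eq offset_def)
  have RK: "?R \<le> dist x k" if "k \<in> K" for k
    using that by (simp add: distK_def infdist_le)
  have im: "x + \<sigma> *\<^sub>R (k - x) \<in> ?O \<and> dist x (x + \<sigma> *\<^sub>R (k - x)) = ?R - \<alpha>" if "k \<in> Theta K x" for k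
  proof -
    have k: "k \<in> K" "norm (k - x) = ?R"
      using that by (auto simp: Theta_def dist_norm norm_minus_commute)
    have "x + \<sigma> *\<^sub>R (k - x) - k = (1 - \<sigma>) *\<^sub>R (x - k)"
      by (simp add: algebra_simps)
    then have "dist (x + \<sigma> *\<^sub>R (k - x)) k = (1 - \<sigma>) * ?R"
      using k \<sigma> by (simp add: dist_norm norm_minus_commute)
    also have "\<dots> = \<alpha>" using \<sigma>(1) by (simp add: algebra_simps)
    finally have "infdist (x + \<sigma> *\<^sub>R (k - x)) K \<le> \<alpha>"
      using infdist_le[OF k(1)] by metis
    then show ?thesis
      using k \<sigma> by (simp add: offset_def dist_norm)
  qed
  obtain k0 where k0: "k0 \<in> Theta K x"
    using Theta_nonempty assms by blast
  have dO: "distK ?O x = ?R - \<alpha>"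
    unfolding distK_def[of ?O]
  proof (rule antisym)
    show "infdist x ?O \<le> ?R - \<alpha>"
      using im[OF k0] infdist_le by metis
    have "?R - \<alpha> \<le> dist x y" if y: "y \<in> ?O" for y
    proof -
      obtain k where "k \<in> K" "dist y k \<le> \<alpha>" using low[OF y] by blast
      then show ?thesis using RK[of k] dist_triangle[of x k y] by simp
    qed
    then show "?R - \<alpha> \<le> infdist x ?O"
      using im[OF k0] by (auto simp: infdist_def intro!: cINF_greatest)
  qed
  show ?thesis
  proof (intro equalityI subsetI)
    fix y assume "y \<in> Theta ?O x"
    then have y: "y \<in> ?O" "dist x y = ?R - \<alpha>"
      by (auto simp: Theta_def dO)
    obtain k where k: "k \<in> K" "dist y k \<le> \<alpha>" using low[OF y(1)] by blast
    then have d: "dist x k = ?R" "dist y k = \<alpha>"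
      using RK[of k] dist_triangle[of x k y] y by auto
    \<comment> \<open>Equality holds in the triangle inequality for \<open>x\<close>,
      \<open>y\<close>, \<open>k\<close>, so \<open>y\<close> lies on the segment from
      \<open>x\<close> to \<open>k\<close>.\<close>
    have "norm (x - y) *\<^sub>R (y - k) = norm (y - k) *\<^sub>R (x - y)"
      using d y by (intro dist_triangle_eq[THEN iffD1]) simp
    then have "(?R - \<alpha>) *\<^sub>R (y - k) = \<alpha> *\<^sub>R (x - y)"
      using d y by (simp add: dist_norm)
    then have "?R *\<^sub>R y = ?R *\<^sub>R x + (?R - \<alpha>) *\<^sub>R (k - x)"
      by (simp add: algebra_simps)
    also have "\<dots> = ?R *\<^sub>R (x + \<sigma> *\<^sub>R (k - x))"
      using \<sigma>(1) by (simp add: scaleR_right_distrib mult.commute)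
    finally have "y = x + \<sigma> *\<^sub>R (k - x)"
      using R by simp
    moreover have "k \<in> Theta K x"
      using k d by (simp add: Theta_def)
    ultimately show "y \<in> (\<lambda>y. x + \<sigma> *\<^sub>R (y - x)) ` Theta K x" by blast
  next
    fix y assume "y \<in> (\<lambda>y. x + \<sigma> *\<^sub>R (y - x)) ` Theta K x"
    then show "y \<in> Theta ?O x"
      using im by (auto simp: Theta_def dO)
  qed
qed

lemma FK_offset:
  assumes "closed K" "K \<noteq> {}" "0 \<le> \<alpha>" "\<alpha> < distK K x"
  shows "FK (offset K \<alpha>) x = (distK K x - \<alpha>) / distK K x * FK K x"
proof -
  define \<sigma> where "\<sigma> = (distK K x - \<alpha>) / distK K x"
  have \<sigma>: "0 < \<sigma>" using assms by (simp add: \<sigma>_def)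
  let ?h = "\<lambda>y. x + \<sigma> *\<^sub>R (y - x)"
  have dist_h: "dist (?h a) (?h b) = \<sigma> * dist a b" for a b
  proof -
    have "?h a - ?h b = \<sigma> *\<^sub>R (a - b)" by (simp add: algebra_simps)
    then show ?thesis using \<sigma> by (simp add: dist_norm)
  qed
  have "mradius (?h ` Theta K x) = \<sigma> * FK K x"
  proof (rule mradius_eqI)
    show "0 \<le> \<sigma> * FK K x"
      using \<sigma> mcenter_Theta(3)[OF assms(1,2)] by simp
    show "?h ` Theta K x \<subseteq> cball (?h (mcenter (Theta K x))) (\<sigma> * FK K x)"
      using mcenter_Theta(4)[OF assms(1,2), of x] \<sigma>
      by (force simp: dist_h simp del: dist_add_cancel)
    fix q \<rho> assume \<rho>: "0 \<le> \<rho>" "?h ` Theta K x \<subseteq> cball q \<rho>"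
    define q' where "q' = x + (1 / \<sigma>) *\<^sub>R (q - x)"
    have q: "q = ?h q'" using \<sigma> by (simp add: q'_def)
    have "Theta K x \<subseteq> cball q' (\<rho> / \<sigma>)"
    proof
      fix y assume "y \<in> Theta K x"
      then have "dist (?h q') (?h y) \<le> \<rho>" using \<rho>(2) q by force
      then show "y \<in> cball q' (\<rho> / \<sigma>)"
        unfolding dist_h using \<sigma> by (simp add: field_simps)
    qed
    then have "FK K x \<le> \<rho> / \<sigma>"
      using \<rho>(1) \<sigma> by (intro mcenter_Theta(5)[OF assms(1,2)]) auto
    then show "\<sigma> * FK K x \<le> \<rho>"
      using \<sigma> by (simp add: field_simps)
  qed
  then show ?thesis
    using Theta_offset[OF assms] by (simp add: FK_def \<sigma>_def)
qed

lemma FK_on_set: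
  assumes "x \<in> A"
  shows "FK A x = 0"
proof -
  have "Theta A x = {x}"
    using assms by (auto simp: Theta_def distK_def)
  then show ?thesis
    by (simp add: FK_def mradius_eqI[of 0 "{x}" x])
qed

section \<open>The implicit Euler step\<close>

text \<open>The step is implicit: \<open>w\<close> is a supergradient at the new point
  \<open>z\<close>. Of the minimisation only this optimality condition is kept. The first norm bound
  serves continuity in \<open>s\<close>, the second the monotonicity of \<open>FK\<close>.\<close>

definition euler_step :: "'a::euclidean_space set \<Rightarrow> real \<Rightarrow> 'a \<Rightarrow> 'a \<Rightarrow> 'a \<Rightarrow> bool" where
  "euler_step K s x w z \<longleftrightarrow>
     supgrad K z w \<and> z = x + s *\<^sub>R w \<and> norm w \<le> 2 * distK K x \<and>
     (1 - s) * norm w \<le> norm (x - mcenter (Theta K x))"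

lemma euler_step_exists:
  fixes K :: "'a::euclidean_space set"
  assumes K: "closed K" "K \<noteq> {}" and M: "\<And>y. distK K y \<le> M" and s: "0 \<le> s" "s \<le> 1/2"
  obtains w z where "euler_step K s x w z"
proof -
  define u where "u = x - mcenter (Theta K x)"
  have Wu: "supgrad K x u" and "(FK K x)\<^sup>2 = (distK K x)\<^sup>2 - (norm u)\<^sup>2"
    using mcenter_Theta[OF K] by (auto simp: u_def)
  then have "(norm u)\<^sup>2 \<le> (distK K x)\<^sup>2"
    by (metis diff_ge_0_iff_ge zero_le_power2)
  then have uR: "norm u \<le> distK K x"
    by (rule power2_le_imp_le) simp
  show thesis
  proof (cases "s = 0")
    \<comment> \<open>For \<open>s = 0\<close> the equation \<open>z = x + s *\<^sub>R w\<close>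
      leaves \<open>w\<close> free; the supergradient of least norm at \<open>x\<close> is
      taken.\<close>
    case True
    then show thesis
      using that[of u x] Wu uR by (simp add: euler_step_def u_def order_trans[OF uR[unfolded u_def]])
  next
    case False
    then have s0: "s > 0" using s by simp
    have M0: "0 \<le> M" using M distK_nonneg order_trans by blast
    define g where "g y = (norm (y - x))\<^sup>2 - s * (distK K y)\<^sup>2" for y
    have "continuous_on (cball x M) g"
      unfolding g_def by (intro continuous_intros)
    then obtain z where z: "\<And>y. y \<in> cball x M \<Longrightarrow> g z \<le> g y"
      using continuous_attains_inf[of "cball x M" g] M0 by (metis cball_eq_empty compact_cball not_le)
    have zmin: "g z \<le> g y" for y
    \<comment> \<open>Outside the ball of radius \<open>M\<close> the function \<open>g\<close> is
      nonnegative, while \<open>g x\<close> is at most 0, so the minimum over the ball is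
      global.\<close>
    proof (cases "y \<in> cball x M")
      case False
      have "s * (distK K y)\<^sup>2 \<le> 1 * M\<^sup>2"
        using s M by (intro mult_mono power_mono) auto
      also have "\<dots> \<le> (norm (y - x))\<^sup>2"
        using False M0 by (simp add: dist_norm norm_minus_commute power_mono)
      finally have "0 \<le> g y" by (simp add: g_def)
      moreover have "g x \<le> 0" using s by (simp add: g_def)
      ultimately show ?thesis using z[of x] M0 by simp
    qed (use z in blast)
    define w where "w = (1 / s) *\<^sub>R (z - x)"
    have zx: "z - x = s *\<^sub>R w" using s0 by (simp add: w_def)
    have W: "supgrad K z w"
      unfolding supgrad_def
    proof
      fix y
      define D where "D = (norm (y - z))\<^sup>2"
      define E where "E = (distK K y)\<^sup>2 - (distK K z)\<^sup>2 - D - 2 * (w \<bullet> (y - z))"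
      \<comment> \<open>Compare \<open>z\<close> with the point a fraction \<open>t\<close> of the
        way to \<open>y\<close>: minimality bounds \<open>distK\<close> there from above,
        semiconcavity from below. Dividing by \<open>t\<close> and letting \<open>t\<close> tend to
        0 gives that \<open>E\<close> is at most 0.\<close>
      have "s * E \<le> t * D" if t: "0 < t" "t \<le> 1" for t
      proof -
        let ?m = "z + t *\<^sub>R (y - z)"
        have "(norm (?m - x))\<^sup>2 = (norm (z - x))\<^sup>2 + 2 * t * ((z - x) \<bullet> (y - z)) + t * t * D"
          unfolding D_def power2_norm_eq_inner
          by (simp add: algebra_simps inner_commute)
        then have "s * (distK K ?m)\<^sup>2 \<le> s * (distK K z)\<^sup>2 + 2 * t * (s * (w \<bullet> (y - z))) + t * t * D"
          using zmin[of ?m] unfolding g_def zx by simp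
        moreover have "s * ((1 - t) * (distK K z)\<^sup>2 + t * (distK K y)\<^sup>2 - t * (1 - t) * D)
            \<le> s * (distK K ?m)\<^sup>2"
          unfolding D_def using s0 t K by (intro mult_left_mono distK_semiconcave) auto
        ultimately have "t * (s * E) \<le> t * (t * D - s * (t * D))"
          unfolding E_def by (simp add: algebra_simps)
        then have "s * E \<le> t * D - s * (t * D)"
          using t by simp
        moreover have "0 \<le> s * (t * D)"
          using s0 t by (simp add: D_def)
        ultimately show ?thesis by linarith
      qed
      then have "eventually (\<lambda>t. s * E \<le> t * D) (at_right 0)"
        by (auto simp: eventually_at_right_field intro!: exI[of _ 1])
      moreover have "((\<lambda>t. t * D) \<longlongrightarrow> 0) (at_right 0)"
        by (auto intro!: tendsto_eq_intros)
      ultimately have "s * E \<le> 0"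
        by (intro tendsto_lowerbound[where F = "at_right 0"]) auto
      then have "E \<le> 0" using s0 by (simp add: mult_le_0_iff)
      then show "(distK K y)\<^sup>2 \<le> (distK K z)\<^sup>2 + (norm (y - z))\<^sup>2 + 2 * (w \<bullet> (y - z))"
        by (simp add: E_def D_def)
    qed
    \<comment> \<open>Monotonicity between the supergradients at \<open>z\<close> and
      \<open>x\<close> yields the bound by \<open>norm u\<close>; \<open>s\<close> at most 1/2 then
      costs the factor 2 in the bound by \<open>distK K x\<close>.\<close>
    have "s * ((w - u) \<bullet> w) \<le> s * (s * (norm w)\<^sup>2)"
      using supgrad_mono[OF W Wu] unfolding zx power2_norm_eq_inner by simp
    then have "(w - u) \<bullet> w \<le> s * (norm w)\<^sup>2"
      using s0 by simp
    then have "(1 - s) * (norm w)\<^sup>2 \<le> u \<bullet> w"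
      by (simp add: inner_diff_left power2_norm_eq_inner algebra_simps)
    also have "\<dots> \<le> norm u * norm w"
      by (rule norm_cauchy_schwarz)
    finally have "((1 - s) * norm w) * norm w \<le> norm u * norm w"
      by (simp add: power2_eq_square mult.assoc)
    then have wu: "(1 - s) * norm w \<le> norm u"
      by (cases "w = 0") auto
    have "1/2 * norm w \<le> (1 - s) * norm w"
      using s by (intro mult_right_mono) auto
    with wu uR have "norm w \<le> 2 * distK K x" by simp
    then show thesis
      using that[of w z] W zx wu by (simp add: euler_step_def u_def algebra_simps)
  qed
qed

text \<open>The supergradient inequality at \<open>z\<close>, tested at the starting point
  \<open>x\<close>.\<close>

lemma euler_step_distK:
  assumes "euler_step K s x w z"
  shows "(distK K x)\<^sup>2 + s * (2 - s) * (norm w)\<^sup>2 \<le> (distK K z)\<^sup>2"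
proof -
  have W: "supgrad K z w" and xz: "x - z = - (s *\<^sub>R w)"
    using assms by (auto simp: euler_step_def)
  have "(norm (x - z))\<^sup>2 + 2 * (w \<bullet> (x - z)) = - (s * (2 - s) * (norm w)\<^sup>2)"
    unfolding xz power2_norm_eq_inner by (simp add: algebra_simps)
  then show ?thesis
    using supgradD[OF W, of x] by linarith
qed

lemma euler_step_distK_mono:
  assumes "euler_step K s x w z" "0 \<le> s" "s \<le> 1"
  shows "distK K x \<le> distK K z"
proof -
  have "0 \<le> s * (2 - s) * (norm w)\<^sup>2" using assms by simp
  then have "(distK K x)\<^sup>2 \<le> (distK K z)\<^sup>2"
    using euler_step_distK[OF assms(1)] by linarith
  then show ?thesis by (rule power2_le_imp_le) simp
qed

text \<open>The gain \<open>s (2 - s) |w|\<^sup>2\<close> in the squared distance and the bound \<open>|w| \<le> |u| / (1 - s)\<close>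
  for the supergradient \<open>u\<close> of least norm at \<open>x\<close> balance exactly, since \<open>s (2 - s) - 1 = - (1 - s)\<^sup>2\<close>.\<close>

lemma euler_step_FK_mono:
  assumes K: "closed K" "K \<noteq> {}" and st: "euler_step K s x w z" "s \<le> 1"
  shows "FK K x \<le> FK K z"
proof -
  let ?u = "norm (x - mcenter (Theta K x))" and ?v = "norm (z - mcenter (Theta K z))"
  have "?v \<le> norm w"
    using st K by (intro mcenter_norm_le_supgrad) (auto simp: euler_step_def)
  then have "?v\<^sup>2 \<le> (norm w)\<^sup>2" by (simp add: power_mono)
  moreover have "((1 - s) * norm w)\<^sup>2 \<le> ?u\<^sup>2"
    using st by (intro power_mono) (auto simp: euler_step_def)
  then have "(norm w)\<^sup>2 - s * (2 - s) * (norm w)\<^sup>2 \<le> ?u\<^sup>2"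
    by (simp add: power_mult_distrib power2_eq_square algebra_simps)
  ultimately have "(FK K x)\<^sup>2 \<le> (FK K z)\<^sup>2"
    using euler_step_distK[OF st(1)] mcenter_Theta(2)[OF K] by (smt (verit))
  then show ?thesis
    using mcenter_Theta(3)[OF K] by (rule power2_le_imp_le)
qed

text \<open>Off the offset, \<open>FK_offset\<close> writes the value as \<open>FK\<close> times
  \<open>1 - \<alpha> / R\<close>, and both factors are nondecreasing along a step; on the offset
  the value is 0.\<close>

lemma euler_step_FK_offset_mono:
  assumes K: "closed K" "K \<noteq> {}" and st: "euler_step K s x w z" "0 \<le> s" "s \<le> 1" and "0 \<le> \<alpha>"
  shows "FK (offset K \<alpha>) x \<le> FK (offset K \<alpha>) z"
proof (cases "distK K x \<le> \<alpha>")
  case True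
  then have "FK (offset K \<alpha>) x = 0"
    by (intro FK_on_set) (simp add: offset_def distK_def)
  moreover have "FK (offset K \<alpha>) z \<ge> 0"
  proof (cases "distK K z \<le> \<alpha>")
    case True
    then show ?thesis
      by (subst FK_on_set) (auto simp: offset_def distK_def)
  next
    case False
    then show ?thesis
      using FK_offset[OF K \<open>0 \<le> \<alpha>\<close>, of z] mcenter_Theta(3)[OF K, of z] by simp
  qed
  ultimately show ?thesis by simp
next
  case False
  have mono: "distK K x \<le> distK K z"
    using st by (rule euler_step_distK_mono)
  have "(distK K x - \<alpha>) / distK K x = 1 - \<alpha> / distK K x" "(distK K z - \<alpha>) / distK K z = 1 - \<alpha> / distK K z"
    using False \<open>0 \<le> \<alpha>\<close> mono by (auto simp: diff_divide_distrib)
  moreover have "\<alpha> / distK K z \<le> \<alpha> / distK K x"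
    using False \<open>0 \<le> \<alpha>\<close> mono by (intro divide_left_mono) auto
  ultimately have "(distK K x - \<alpha>) / distK K x \<le> (distK K z - \<alpha>) / distK K z"
    by simp
  moreover have "FK K x \<le> FK K z"
    using K st by (intro euler_step_FK_mono) auto
  ultimately have "(distK K x - \<alpha>) / distK K x * FK K x \<le> (distK K z - \<alpha>) / distK K z * FK K z"
    using False mono mcenter_Theta(3)[OF K] by (intro mult_mono) auto
  then show ?thesis
    using FK_offset[OF K \<open>0 \<le> \<alpha>\<close>] False mono by simp
qed

text \<open>Pair the difference of the two step equations with \<open>z - z'\<close>. By
  monotonicity the supergradient difference contributes at most \<open>s |z - z'|^2\<close>, and
  \<open>s\<close> at most 1/2 lets half of the left side absorb it.\<close>

lemma euler_step_lipschitz: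
  assumes "euler_step K s x w z" "euler_step K s' x' w' z'" "0 \<le> s" "s \<le> 1/2"
  shows "norm (z - z') \<le> 2 * (norm (x - x') + \<bar>s - s'\<bar> * norm w')"
proof -
  let ?d = "z - z'"
  have W: "supgrad K z w" "supgrad K z' w'" and z: "z = x + s *\<^sub>R w" "z' = x' + s' *\<^sub>R w'"
    using assms by (auto simp: euler_step_def)
  have "?d = (x - x') + (s - s') *\<^sub>R w' + s *\<^sub>R (w - w')"
    unfolding z by (simp add: algebra_simps)
  then have "?d \<bullet> ?d = ((x - x') + (s - s') *\<^sub>R w' + s *\<^sub>R (w - w')) \<bullet> ?d"
    by simp
  also have "\<dots> = ((x - x') + (s - s') *\<^sub>R w') \<bullet> ?d + s * ((w - w') \<bullet> ?d)"
    by (simp only: inner_add_left inner_scaleR_left)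
  also have "\<dots> \<le> norm ((x - x') + (s - s') *\<^sub>R w') * norm ?d + 1/2 * (norm ?d)\<^sup>2"
  proof (rule add_mono[OF norm_cauchy_schwarz])
    have "s * ((w - w') \<bullet> ?d) \<le> s * (norm ?d)\<^sup>2"
      using supgrad_mono[OF W] assms by (intro mult_left_mono) auto
    also have "\<dots> \<le> 1/2 * (norm ?d)\<^sup>2"
      using assms by (intro mult_right_mono) auto
    finally show "s * ((w - w') \<bullet> ?d) \<le> 1/2 * (norm ?d)\<^sup>2" .
  qed
  finally have "norm ?d * norm ?d \<le> (2 * norm ((x - x') + (s - s') *\<^sub>R w')) * norm ?d"
    by (simp add: power2_eq_square flip: power2_norm_eq_inner)
  then have "norm ?d \<le> 2 * norm ((x - x') + (s - s') *\<^sub>R w')"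
    by (cases "?d = 0") auto
  also have "\<dots> \<le> 2 * (norm (x - x') + \<bar>s - s'\<bar> * norm w')"
    using norm_triangle_ineq[of "x - x'" "(s - s') *\<^sub>R w'"] by simp
  finally show ?thesis .
qed

section \<open>The Euler map and its homotopies\<close>

text \<open>The choice is harmless for \<open>s\<close> in [0, 1/2]:
  \<open>euler_step_lipschitz\<close> with equal parameters and starting points shows that
  \<open>z\<close> is unique.\<close>

definition euler_map :: "'a::euclidean_space set \<Rightarrow> real \<Rightarrow> 'a \<Rightarrow> 'a" where
  "euler_map K s x = (SOME z. \<exists>w. euler_step K s x w z)"

lemma euler_map_step:
  assumes "closed K" "K \<noteq> {}" "\<And>y. distK K y \<le> M" "0 \<le> s" "s \<le> 1/2"
  obtains w where "euler_step K s x w (euler_map K s x)"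
proof -
  have "\<exists>z w. euler_step K s x w z"
    using euler_step_exists[OF assms] by metis
  then have "\<exists>w. euler_step K s x w (euler_map K s x)"
    unfolding euler_map_def by (rule someI_ex)
  then show thesis using that by blast
qed

lemma continuous_on_euler_map:
  fixes K :: "'a::euclidean_space set"
  assumes K: "closed K" "K \<noteq> {}" and M: "\<And>y. distK K y \<le> M"
  shows "continuous_on ({0..1/2} \<times> UNIV) (\<lambda>(s, x). euler_map K s x)"
proof (rule lipschitz_on_continuous_on)
  have M0: "0 \<le> M" using M distK_nonneg order_trans by blast
  show "(2 + 4 * M)-lipschitz_on ({0..1/2} \<times> UNIV) (\<lambda>(s, x). euler_map K s x)"
  proof (rule lipschitz_onI)
    fix p q :: "real \<times> 'a"
    assume pq: "p \<in> {0..1/2} \<times> UNIV" "q \<in> {0..1/2} \<times> UNIV"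
    obtain s x s' x' where p: "p = (s, x)" and q: "q = (s', x')"
      by (metis surj_pair)
    have s: "0 \<le> s" "s \<le> 1/2" "0 \<le> s'" "s' \<le> 1/2"
      using pq by (auto simp: p q)
    obtain w w' where st: "euler_step K s x w (euler_map K s x)" "euler_step K s' x' w' (euler_map K s' x')"
      using euler_map_step[OF K M] s by metis
    have w': "norm w' \<le> 2 * M"
      using st(2) M[of x'] by (simp add: euler_step_def)
    have d: "norm (x - x') \<le> dist p q" "\<bar>s - s'\<bar> \<le> dist p q"
      using dist_snd_le[of p q] dist_fst_le[of p q] by (simp_all add: p q dist_norm)
    have "dist (euler_map K s x) (euler_map K s' x') \<le> 2 * (norm (x - x') + \<bar>s - s'\<bar> * norm w')"
      unfolding dist_norm using st s by (intro euler_step_lipschitz) auto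
    also have "\<dots> \<le> 2 * (dist p q + dist p q * (2 * M))"
      using d w' M0 by (intro mult_left_mono add_mono mult_mono) auto
    finally show "dist (case p of (s, x) \<Rightarrow> euler_map K s x) (case q of (s, x) \<Rightarrow> euler_map K s x)
        \<le> (2 + 4 * M) * dist p q"
      by (simp add: p q algebra_simps)
  qed (use M0 in simp)
qed

text \<open>Letting the step size run from 0, where the map is the identity, to 1/2 gives the
  homotopy for one step; invariance of \<open>A\<close> for all these sizes keeps it inside
  \<open>A\<close>. Composition gives the iterates.\<close>

lemma homotopic_id_funpow_euler_map:
  fixes K :: "'a::euclidean_space set"
  assumes K: "closed K" "K \<noteq> {}" and M: "\<And>y. distK K y \<le> M"
    and A: "\<And>s x. 0 \<le> s \<Longrightarrow> s \<le> 1/2 \<Longrightarrow> x \<in> A \<Longrightarrow> euler_map K s x \<in> A"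
  shows "homotopic_with_canon (\<lambda>_. True) A A id (euler_map K (1/2) ^^ n)"
proof (induction n)
  case 0
  show ?case by simp
next
  case (Suc n)
  have "homotopic_with_canon (\<lambda>_. True) A A id (euler_map K (1/2))"
  proof -
    let ?h = "\<lambda>p. euler_map K (fst p / 2) (snd p)"
    have "continuous_on ({0..1} \<times> A) ((\<lambda>(s, x). euler_map K s x) \<circ> (\<lambda>p. (fst p / 2, snd p)))"
      by (intro continuous_on_compose continuous_on_subset[OF continuous_on_euler_map[OF K M]] continuous_intros) auto
    then have "continuous_on ({0..1} \<times> A) ?h" by (simp add: o_def)
    moreover have "euler_map K 0 x = x" for x
    proof -
      obtain w where "euler_step K 0 x w (euler_map K 0 x)"
        using euler_map_step[OF K M, of 0 x] by auto
      then show ?thesis by (simp add: euler_step_def)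
    qed
    ultimately show ?thesis
      by (auto simp: homotopic_with_def image_subset_iff A intro!: exI[of _ ?h])
  qed
  then have "homotopic_with_canon (\<lambda>_. True) A A (id \<circ> id) (euler_map K (1/2) \<circ> euler_map K (1/2) ^^ n)"
    using homotopic_compose Suc.IH by blast
  then show ?case by (simp only: id_comp funpow.simps(2))
qed

section \<open>Lower bound for the gradient outside the medial axis\<close>

lemma distK_bounded:
  fixes K :: "'a::euclidean_space set"
  assumes "bounded (- K)" "K \<noteq> {}"
  obtains M where "\<And>x. distK K x \<le> M"
proof -
  obtain k where k: "k \<in> K" using assms by blast
  obtain B where B: "\<And>x. x \<notin> K \<Longrightarrow> dist x k \<le> B"
    using assms(1) unfolding bounded_any_center[of _ k] by (auto simp: dist_commute)
  have "distK K x \<le> max 0 B" for x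
  proof (cases "x \<in> K")
    case False
    then show ?thesis
      using infdist_le[OF k, of x] B[of x] by (simp add: distK_def)
  qed (simp add: distK_def)
  then show thesis using that by blast
qed

lemma norm_gradK_ge:
  assumes M: "\<And>y. distK K y \<le> M" and x: "0 \<le> a" "a < distK K x" "ereal (distK K x) < rmu \<mu> a K"
  shows "\<mu> \<le> norm (gradK K x)"
proof -
  let ?t = "distK K x"
  have "x \<notin> K" using x by (auto simp: distK_def)
  then have "?t \<le> Rmax K"
    unfolding Rmax_def using M by (intro cSUP_upper) (auto simp: bdd_above_def)
  moreover have "?t \<notin> {t. a < t \<and> 0 < t \<and> t \<le> Rmax K \<and> chiK K t < \<mu>}"
    using x(3) unfolding rmu_def less_le_not_le by (auto intro!: Inf_lower)
  ultimately have "\<mu> \<le> chiK K ?t" using x by auto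
  also have "\<dots> \<le> norm (gradK K x)"
    unfolding chiK_def by (auto intro!: cINF_lower bdd_belowI[of _ 0])
  finally show ?thesis .
qed

text \<open>Fix \<beta> strictly between \<alpha> + \<open>lam\<close> and the \<mu>-reach. Up to
  distance \<beta> the reach bounds the gradient below by \<mu>. Beyond \<beta>, being outside
  \<open>ax\<close> makes \<open>FK\<close> at most \<open>lam / (\<beta> - \<alpha>)\<close> times
  \<open>R\<close>, a ratio below 1, so \<open>|R \<nabla>|^2 = R^2 - F^2\<close> is at least
  \<open>\<kappa>^2 R^2\<close>. Finally \<open>R\<close> exceeds \<alpha>'.\<close>

lemma mcenter_norm_lower_bound:
  fixes K :: "'a::euclidean_space set"
  assumes K: "closed K" "K \<noteq> {}" and M: "\<And>y. distK K y \<le> M"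
    and par: "0 < lam" "0 < \<mu>" "0 < \<alpha>'" "\<alpha>' \<le> \<alpha>"
    and rmu: "ereal (\<alpha> + lam) < rmu \<mu> \<alpha>' K"
  obtains c where "0 < c"
    "\<And>x. \<alpha>' < distK K x \<Longrightarrow> x \<notin> ax lam \<alpha> K \<Longrightarrow> c \<le> norm (x - mcenter (Theta K x))"
proof -
  obtain \<beta> where \<beta>: "\<alpha> + lam < \<beta>" "ereal \<beta> < rmu \<mu> \<alpha>' K"
    using ereal_dense2[OF rmu] by auto
  define \<kappa> where "\<kappa> = sqrt (1 - (lam / (\<beta> - \<alpha>))\<^sup>2)"
  have "0 \<le> lam / (\<beta> - \<alpha>)" "lam / (\<beta> - \<alpha>) < 1"
    using par \<beta> by auto
  then have l1: "(lam / (\<beta> - \<alpha>))\<^sup>2 < 1"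
    by (simp add: power_less_one_iff)
  then have \<kappa>: "0 < \<kappa>" "\<kappa>\<^sup>2 = 1 - (lam / (\<beta> - \<alpha>))\<^sup>2"
    by (simp_all add: \<kappa>_def)
  show thesis
  proof (rule that)
    show "0 < min \<mu> \<kappa> * \<alpha>'" using par \<kappa> by simp
    fix x assume x: "\<alpha>' < distK K x" "x \<notin> ax lam \<alpha> K"
    let ?v = "norm (x - mcenter (Theta K x))" and ?R = "distK K x"
    have R: "?R > 0" using x par by simp
    have "min \<mu> \<kappa> * ?R \<le> ?v"
    proof (cases "?R \<le> \<beta>")
      case True
      have "\<mu> \<le> norm (gradK K x)"
        using M par x True \<beta> by (intro norm_gradK_ge[of K M \<alpha>']) (auto intro: order_le_less_trans[of _ "ereal \<beta>"])
      also have "\<dots> = ?v / ?R"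
        using R by (simp add: gradK_def divide_inverse mult.commute)
      finally have "\<mu> * ?R \<le> ?v" using R by (simp add: field_simps)
      moreover have "min \<mu> \<kappa> * ?R \<le> \<mu> * ?R"
        using R by (intro mult_right_mono) auto
      ultimately show ?thesis by linarith
    next
      case False
      then have R\<alpha>: "\<beta> - \<alpha> < ?R - \<alpha>" "0 < \<beta> - \<alpha>" using \<beta> par by auto
      have "(?R - \<alpha>) / ?R * FK K x < lam"
        using FK_offset[OF K, of \<alpha> x] x R\<alpha> par by (simp add: ax_def)
      then have "FK K x < lam / (?R - \<alpha>) * ?R"
        using R R\<alpha> by (simp add: field_simps)
      also have "\<dots> \<le> lam / (\<beta> - \<alpha>) * ?R"
        using R R\<alpha> par by (intro mult_right_mono divide_left_mono) auto
      finally have "(FK K x)\<^sup>2 \<le> (lam / (\<beta> - \<alpha>) * ?R)\<^sup>2"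
        using mcenter_Theta(3)[OF K] by (intro power_mono) auto
      then have "?R\<^sup>2 - ?v\<^sup>2 \<le> (1 - \<kappa>\<^sup>2) * ?R\<^sup>2"
        unfolding mcenter_Theta(2)[OF K] power_mult_distrib \<kappa>(2) by simp
      then have "(\<kappa> * ?R)\<^sup>2 \<le> ?v\<^sup>2"
        by (simp add: power_mult_distrib algebra_simps)
      then have "\<kappa> * ?R \<le> ?v"
        by (rule power2_le_imp_le) simp
      moreover have "min \<mu> \<kappa> * ?R \<le> \<kappa> * ?R"
        using R by (intro mult_right_mono) auto
      ultimately show ?thesis by linarith
    qed
    moreover have "min \<mu> \<kappa> * \<alpha>' \<le> min \<mu> \<kappa> * ?R"
      using x par \<kappa> by (intro mult_left_mono) auto
    ultimately show "min \<mu> \<kappa> * \<alpha>' \<le> ?v" by linarith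
  qed
qed

lemma ax_subset_compl_offset:
  assumes "0 < lam" "\<alpha>' \<le> \<alpha>"
  shows "ax lam \<alpha> K \<subseteq> - offset K \<alpha>'"
proof
  fix x assume "x \<in> ax lam \<alpha> K"
  then have "x \<notin> offset K \<alpha>"
    using FK_on_set[of x "offset K \<alpha>"] assms by (auto simp: ax_def)
  then show "x \<in> - offset K \<alpha>'" using assms by (simp add: offset_def)
qed

section \<open>The homotopy equivalence\<close>

theorem theorem9p7:
  fixes K :: "'a::euclidean_space set"
    and \<alpha> \<alpha>' lam \<mu> :: real
  assumes "closed K" and "bounded (- K)"
    and "\<alpha> \<ge> 0" and "lam > 0" and "0 < \<mu>" and "\<mu> \<le> 1"
    and "0 < \<alpha>'" and "\<alpha>' \<le> \<alpha>"
    and "rmu \<mu> \<alpha>' K > ereal (\<alpha> + lam)"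
  shows "ax lam \<alpha> K homotopy_eqv (- offset K \<alpha>')"
proof -
  let ?A = "ax lam \<alpha> K" and ?U = "- offset K \<alpha>'"
  have U: "?U = {x. \<alpha>' < distK K x}"
    by (auto simp: offset_def distK_def)
  have "K \<noteq> {}" using assms(2) by auto
  with assms(1) have K: "closed K" "K \<noteq> {}" by auto
  obtain M where M: "\<And>x. distK K x \<le> M"
    using distK_bounded[OF assms(2) K(2)] by blast
  obtain c where c: "0 < c"
    "\<And>x. \<alpha>' < distK K x \<Longrightarrow> x \<notin> ?A \<Longrightarrow> c \<le> norm (x - mcenter (Theta K x))"
    using mcenter_norm_lower_bound[OF K M assms(4,5,7-9)] by blast
  have stepA: "euler_map K s x \<in> ?A" if s: "0 \<le> s" "s \<le> 1/2" and x: "x \<in> ?A" for s x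
  proof -
    obtain w where w: "euler_step K s x w (euler_map K s x)"
      using euler_map_step[OF K M s] by blast
    have "FK (offset K \<alpha>) x \<le> FK (offset K \<alpha>) (euler_map K s x)"
      using s assms(3) by (intro euler_step_FK_offset_mono[OF K w]) auto
    then show ?thesis using x by (simp add: ax_def)
  qed
  have stepU: "euler_map K s x \<in> ?U" if s: "0 \<le> s" "s \<le> 1/2" and x: "x \<in> ?U" for s x
  proof -
    obtain w where w: "euler_step K s x w (euler_map K s x)"
      using euler_map_step[OF K M s] by blast
    have "distK K x \<le> distK K (euler_map K s x)"
      using s by (intro euler_step_distK_mono[OF w]) auto
    then show ?thesis using x by (simp add: U)
  qed
  let ?J = "euler_map K (1/2)"
  \<comment> \<open>The gain per step is \<open>s * (2 - s)\<close> times \<open>c^2\<close>, and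
    \<open>s = 1/2\<close> gives 3/4.\<close>
  have progress: "(?J ^^ n) x \<in> ?A \<or> (?J ^^ n) x \<in> ?U \<and> real n * (3/4 * c\<^sup>2) \<le> (distK K ((?J ^^ n) x))\<^sup>2"
    if x: "x \<in> ?U" for n x
  proof (induction n)
    case 0
    then show ?case using x by simp
  next
    case (Suc n)
    define y where "y = (?J ^^ n) x"
    have Jy: "(?J ^^ Suc n) x = ?J y" by (simp add: y_def)
    show ?case
    proof (cases "y \<in> ?A \<or> ?J y \<in> ?A")
      case True
      then show ?thesis using stepA[of "1/2" y] unfolding Jy by auto
    next
      case False
      then have y: "y \<in> ?U" "real n * (3/4 * c\<^sup>2) \<le> (distK K y)\<^sup>2"
        using Suc by (auto simp: y_def)
      have Jy_U: "?J y \<in> ?U" using stepU[of "1/2" y] y by simp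
      obtain w where w: "euler_step K (1/2) y w (?J y)"
        using euler_map_step[OF K M, of "1/2" y] by auto
      \<comment> \<open>The bound \<open>c\<close> is used at the new point, where \<open>w\<close>
        is a supergradient; hence the case split also asks whether \<open>?J y\<close> has reached
        the axis.\<close>
      have "c \<le> norm (?J y - mcenter (Theta K (?J y)))"
        using Jy_U False by (intro c(2)) (auto simp: U)
      also have "\<dots> \<le> norm w"
        using w K by (intro mcenter_norm_le_supgrad) (auto simp: euler_step_def)
      finally have "c\<^sup>2 \<le> (norm w)\<^sup>2"
        using c(1) by (intro power_mono) auto
      then have "(distK K y)\<^sup>2 + 3/4 * c\<^sup>2 \<le> (distK K (?J y))\<^sup>2"
        using euler_step_distK[OF w] by simp
      with y Jy_U show ?thesis unfolding Jy by (simp add: algebra_simps)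
    qed
  qed
  obtain n where n: "M\<^sup>2 < real n * (3/4 * c\<^sup>2)"
    using reals_Archimedean3[of "3/4 * c\<^sup>2"] c(1) by auto
  have JU: "(?J ^^ n) x \<in> ?A" if "x \<in> ?U" for x
  proof -
    have "(distK K ((?J ^^ n) x))\<^sup>2 \<le> M\<^sup>2"
      using M by (intro power_mono) auto
    then show ?thesis using progress[OF that, of n] n by auto
  qed
  have homA: "homotopic_with_canon (\<lambda>_. True) ?A ?A id (?J ^^ n)"
    using K M stepA by (rule homotopic_id_funpow_euler_map)
  have homU: "homotopic_with_canon (\<lambda>_. True) ?U ?U id (?J ^^ n)"
    using K M stepU by (rule homotopic_id_funpow_euler_map)
  have "continuous_on ?U (?J ^^ n)"
    using homotopic_with_imp_continuous[OF homU] by blast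
  then have "continuous_map (top_of_set ?U) (top_of_set ?A) (?J ^^ n)"
    using JU by auto
  moreover have "continuous_map (top_of_set ?A) (top_of_set ?U) id"
    using ax_subset_compl_offset[OF assms(4,8), of K] by auto
  \<comment> \<open>The iterate, as a map from \<open>?U\<close> to \<open>?A\<close>, and the
    inclusion compose in either order to the iterate itself, which is homotopic to the identity on
    both spaces.\<close>
  ultimately show ?thesis
    unfolding homotopy_equivalent_space_def
    using homA homU by (metis comp_id id_comp homotopic_with_symD)
qed

end
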